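(* Let $\Sigma_1=(G_1,\sigma_1)$ and $\Sigma_2=(G_2,\sigma_2)$ be two finite, simple, connected signed graphs, where $\Sigma_2$ is all-positive. Then the HG-lexicographic product satisfies $\operatorname{bdim}(\Sigma_1[\Sigma_2])=\operatorname{bdim}(\Sigma_1)$.
   Context: A signed graph $\Sigma=(G,\sigma)$ is a graph $G=(V,E)$ with a function $\sigma:E\to\{+1,-1\}$; it is all-positive if every edge has sign $+1$. All graphs are finite, simple, connected and undirected unless otherwise mentioned. Let $\Omega=\{-1,0,1\}$, with $\Omega^k\subset\mathbb{R}^k$ carrying the standard inner product $\langle\cdot,\cdot\rangle$. A vector valued switching function ($k$-switching function) for $\Sigma$ is a map $\zeta:V\to\Omega^k$ with $\langle\zeta(u),\zeta(v)\rangle\neq 0$ for every edge $uv\in E$; the switched signed graph $\Sigma^\zeta=(G,\sigma^\zeta)$ has $\sigma^\zeta(uv)=\sigma(uv)\operatorname{sgn}(\langle\zeta(u),\zeta(v)\rangle)$. The balancing dimension $\operatorname{bdim}(\Sigma)$ is the least integer $k\ge 1$ for which there is a $k$-switching function $\zeta:V\to\Omega^k$ such that $\Sigma^\zeta$ is all-positive. The lexicographic product $G_1[G_2]$ of graphs has vertex set $V(G_1)\times V(G_2)$, with $(u_i,v_j)$ adjacent to $(u_k,v_l)$ iff $u_i\sim u_k$ in $G_1$, or $u_i=u_k$ and $v_j\sim v_l$ in $G_2$. The HG-lexicographic product $\Sigma_1[\Sigma_2]$ is the signed graph on $G_1[G_2]$ with signature $\sigma((u_i,v_j)(u_k,v_l))=\sigma_1(u_iu_k)$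 if $i\ne k$, and $=\sigma_2(v_jv_l)$ if $i=k$. *)

theory Defs
  imports "Graph_Theory.Graph_Theory" "Jordan_Normal_Form.Matrix"
begin

text \<open>
  An edge \<open>uv\<close> of a simple undirected graph is the pair of arcs \<open>(u, v)\<close>, \<open>(v, u)\<close>
  of a \<open>pair_graph\<close>; hence a signature must take the same value on both arcs.
  The values of \<open>signature\<close> outside \<open>parcs\<close> are irrelevant.
\<close>

record 'a signed_pre_graph =
  underlying :: "'a pair_pre_digraph"
  signature :: "'a \<times> 'a \<Rightarrow> real"

abbreviation sverts :: "'a signed_pre_graph \<Rightarrow> 'a set" where
  "sverts \<Sigma> \<equiv> pverts (underlying \<Sigma>)"

abbreviation sarcs :: "'a signed_pre_graph \<Rightarrow> 'a rel" where
  "sarcs \<Sigma> \<equiv> parcs (underlying \<Sigma>)"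

text \<open>
  Finite, simple, connected signed graphs. Note that \<open>connected\<close> from
  \<open>Graph_Theory\<close> includes that the graph has at least one vertex.
\<close>

locale connected_signed_graph =
  fixes \<Sigma> :: "'a signed_pre_graph"
  assumes pair_graph_underlying: "pair_graph (underlying \<Sigma>)"
    and connected_underlying: "connected (with_proj (underlying \<Sigma>))"
    and signature_range: "e \<in> sarcs \<Sigma> \<Longrightarrow> signature \<Sigma> e \<in> {1, -1}"
    and signature_sym: "(u, v) \<in> sarcs \<Sigma> \<Longrightarrow> signature \<Sigma> (u, v) = signature \<Sigma> (v, u)"

definition all_positive :: "'a signed_pre_graph \<Rightarrow> bool" where
  "all_positive \<Sigma> \<longleftrightarrow> (\<forall>e \<in> sarcs \<Sigma>. signature \<Sigma> e = 1)"

definition Omega :: "nat \<Rightarrow> real vec set" where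
  "Omega k = {x \<in> carrier_vec k. \<forall>i < k. x $ i \<in> {-1, 0, 1}}"

definition switching_function :: "nat \<Rightarrow> 'a signed_pre_graph \<Rightarrow> ('a \<Rightarrow> real vec) \<Rightarrow> bool" where
  "switching_function k \<Sigma> \<zeta> \<longleftrightarrow>
     \<zeta> \<in> sverts \<Sigma> \<rightarrow> Omega k \<and>
     (\<forall>(u, v) \<in> sarcs \<Sigma>. \<zeta> u \<bullet> \<zeta> v \<noteq> 0)"

definition switch :: "('a \<Rightarrow> real vec) \<Rightarrow> 'a signed_pre_graph \<Rightarrow> 'a signed_pre_graph" where
  "switch \<zeta> \<Sigma> =
     \<lparr> underlying = underlying \<Sigma>,
       signature = (\<lambda>(u, v). signature \<Sigma> (u, v) * sgn (\<zeta> u \<bullet> \<zeta> v)) \<rparr>"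

definition bdim :: "'a signed_pre_graph \<Rightarrow> nat" where
  "bdim \<Sigma> =
     (LEAST k. 1 \<le> k \<and> (\<exists>\<zeta>. switching_function k \<Sigma> \<zeta> \<and> all_positive (switch \<zeta> \<Sigma>)))"

definition lex_graph ::
  "'a pair_pre_digraph \<Rightarrow> 'b pair_pre_digraph \<Rightarrow> ('a \<times> 'b) pair_pre_digraph" where
  "lex_graph G H =
     \<lparr> pverts = pverts G \<times> pverts H,
       parcs = {((u, v), (u', v')).
          (u, v) \<in> pverts G \<times> pverts H \<and> (u', v') \<in> pverts G \<times> pverts H \<and>
          ((u, u') \<in> parcs G \<or> u = u' \<and> (v, v') \<in> parcs H)} \<rparr>"

definition HG_lex_product ::
  "'a signed_pre_graph \<Rightarrow> 'b signed_pre_graph \<Rightarrow> ('a \<times> 'b) signed_pre_graph" where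
  "HG_lex_product \<Sigma>1 \<Sigma>2 =
     \<lparr> underlying = lex_graph (underlying \<Sigma>1) (underlying \<Sigma>2),
       signature = (\<lambda>((u, v), (u', v')).
          if u \<noteq> u' then signature \<Sigma>1 (u, u') else signature \<Sigma>2 (v, v')) \<rparr>"

text \<open>The minimum in the definition of \<open>bdim\<close> is attained.\<close>

lemma bdim_attained:
  assumes "connected_signed_graph \<Sigma>"
  shows "1 \<le> bdim \<Sigma> \<and>
    (\<exists>\<zeta>. switching_function (bdim \<Sigma>) \<Sigma> \<zeta> \<and> all_positive (switch \<zeta> \<Sigma>))"
proof -
  interpret connected_signed_graph \<Sigma> by fact
  interpret G: pair_graph "underlying \<Sigma>" by (rule pair_graph_underlying)
  define k where "k = Suc (card (sarcs \<Sigma>))"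
  obtain f where f: "bij_betw f {..<card (sarcs \<Sigma>)} (sarcs \<Sigma>)"
    using ex_bij_betw_nat_finite[OF G.pair_finite_arcs] by (auto simp: atLeast0LessThan)
  define h where "h w e = (if fst e = w then 1 else if snd e = w then signature \<Sigma> e else 0)"
    for w e
  define \<zeta> where
    "\<zeta> w = vec k (\<lambda>i. if i < card (sarcs \<Sigma>) then h w (f i) else 0)" for w
  have fin: "f i \<in> sarcs \<Sigma>" if "i < card (sarcs \<Sigma>)" for i
    using f that by (auto simp: bij_betw_def)
  have "\<zeta> w \<in> Omega k" for w
    using signature_range[OF fin] by (auto simp: Omega_def \<zeta>_def h_def)
  moreover have prod: "\<zeta> u \<bullet> \<zeta> v = 2 * signature \<Sigma> (u, v)" if uv: "(u, v) \<in> sarcs \<Sigma>" for u v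
  proof -
    have ne: "u \<noteq> v" using uv G.no_loops' by blast
    have vu: "(v, u) \<in> sarcs \<Sigma>" using uv G.arcs_symmetric by blast
    have "\<zeta> u \<bullet> \<zeta> v = (\<Sum>i < card (sarcs \<Sigma>). h u (f i) * h v (f i))"
      by (simp add: scalar_prod_def \<zeta>_def k_def atLeast0LessThan)
    also have "\<dots> = (\<Sum>e \<in> sarcs \<Sigma>. h u e * h v e)"
      by (rule sum.reindex_bij_betw[OF f])
    also have "\<dots> = (\<Sum>e \<in> {(u, v), (v, u)}. h u e * h v e)"
      using uv vu ne G.pair_finite_arcs
      by (intro sum.mono_neutral_right) (auto simp: h_def split: if_splits)
    also have "\<dots> = 2 * signature \<Sigma> (u, v)"
      using ne signature_sym[OF uv] by (simp add: h_def)
    finally show ?thesis .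
  qed
  ultimately have "switching_function k \<Sigma> \<zeta>"
    using signature_range by (fastforce simp: switching_function_def)
  moreover have "all_positive (switch \<zeta> \<Sigma>)"
    using signature_range prod by (fastforce simp: all_positive_def switch_def)
  ultimately have "1 \<le> k \<and> (\<exists>\<zeta>. switching_function k \<Sigma> \<zeta> \<and> all_positive (switch \<zeta> \<Sigma>))"
    by (auto simp: k_def)
  then show ?thesis
    unfolding bdim_def by (rule LeastI)
qed

lemma connected_iff_strongly_connected:
  assumes "pair_graph G"
  shows "connected (with_proj G) \<longleftrightarrow> strongly_connected (with_proj G)"
proof -
  interpret pair_graph G by fact
  have "parcs (mk_symmetric (with_proj G)) = parcs G"
    by (auto simp: mk_symmetric_def intro: arcs_symmetric)
  moreover have "pverts (mk_symmetric (with_proj G)) = pverts G"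
    by (simp add: mk_symmetric_def)
  ultimately show ?thesis
    by (simp add: connected_def strongly_connected_def reachable_def)
qed

lemma connected_signed_graph_HG_lex_product:
  assumes "connected_signed_graph \<Sigma>1" "connected_signed_graph \<Sigma>2"
  shows "connected_signed_graph (HG_lex_product \<Sigma>1 \<Sigma>2)"
proof -
  interpret S1: connected_signed_graph \<Sigma>1 by fact
  interpret S2: connected_signed_graph \<Sigma>2 by fact
  interpret G: pair_graph "underlying \<Sigma>1" by (rule S1.pair_graph_underlying)
  interpret H: pair_graph "underlying \<Sigma>2" by (rule S2.pair_graph_underlying)
  define P where "P = lex_graph (underlying \<Sigma>1) (underlying \<Sigma>2)"
  have u: "underlying (HG_lex_product \<Sigma>1 \<Sigma>2) = P"
    by (simp add: HG_lex_product_def P_def)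
  have pg: "pair_graph P"
  proof
    show "finite (pverts P)"
      by (simp add: P_def lex_graph_def G.pair_finite_verts H.pair_finite_verts)
    show "finite (parcs P)"
      by (rule finite_subset[of _ "(sverts \<Sigma>1 \<times> sverts \<Sigma>2) \<times> (sverts \<Sigma>1 \<times> sverts \<Sigma>2)"])
        (auto simp: P_def lex_graph_def G.pair_finite_verts H.pair_finite_verts)
    show "Digraph.symmetric (with_proj P)"
      by (auto simp: symmetric_def P_def lex_graph_def intro!: symI
          intro: G.arcs_symmetric H.arcs_symmetric)
  qed (auto simp: P_def lex_graph_def dest: G.no_loops' H.no_loops')
  have "strongly_connected (with_proj P)"
  proof
    have 1: "strongly_connected (with_proj (underlying \<Sigma>1))"
      and 2: "strongly_connected (with_proj (underlying \<Sigma>2))"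
      using S1.connected_underlying S2.connected_underlying
        connected_iff_strongly_connected G.pair_graph H.pair_graph by blast+
    then show "verts (with_proj P) \<noteq> {}"
      by (auto simp: strongly_connected_def P_def lex_graph_def)
    fix x y
    assume "x \<in> verts (with_proj P)" "y \<in> verts (with_proj P)"
    then obtain a b c d where xy: "x = (a, b)" "y = (c, d)" and mem:
      "a \<in> sverts \<Sigma>1" "c \<in> sverts \<Sigma>1" "b \<in> sverts \<Sigma>2" "d \<in> sverts \<Sigma>2"
      by (auto simp: P_def lex_graph_def)
    have "(a, c) \<in> rtrancl_on (sverts \<Sigma>1) (sarcs \<Sigma>1)"
      using 1 mem by (auto simp: strongly_connected_def reachable_def)
    then have A: "((a, b), (c, b)) \<in> rtrancl_on (pverts P) (parcs P)"
      by induct (use mem in \<open>auto simp: P_def lex_graph_def intro: converse_rtrancl_on_into_rtrancl_on\<close>)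
    have "(b, d) \<in> rtrancl_on (sverts \<Sigma>2) (sarcs \<Sigma>2)"
      using 2 mem by (auto simp: strongly_connected_def reachable_def)
    then have B: "((c, b), (c, d)) \<in> rtrancl_on (pverts P) (parcs P)"
      by induct (use mem in \<open>auto simp: P_def lex_graph_def intro: converse_rtrancl_on_into_rtrancl_on\<close>)
    from rtrancl_on_trans[OF A B] show "x \<rightarrow>\<^sup>*\<^bsub>with_proj P\<^esub> y"
      by (simp add: reachable_def xy)
  qed
  then have con: "connected (with_proj P)"
    using connected_iff_strongly_connected[OF pg] by simp
  show ?thesis
    unfolding connected_signed_graph_def u
  proof (intro conjI allI impI)
    show "signature (HG_lex_product \<Sigma>1 \<Sigma>2) e \<in> {1, -1}" if "e \<in> parcs P" for e
      using that S1.signature_range S2.signature_range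
      by (fastforce simp: HG_lex_product_def P_def lex_graph_def dest: G.no_loops')
    show "signature (HG_lex_product \<Sigma>1 \<Sigma>2) (x, y) = signature (HG_lex_product \<Sigma>1 \<Sigma>2) (y, x)"
      if "(x, y) \<in> parcs P" for x y
      using that S1.signature_sym S2.signature_sym G.no_loops'
      by (fastforce simp: HG_lex_product_def P_def lex_graph_def)
  qed (fact pg con)+
qed

end

theory Submission
  imports Defs
begin

text \<open>
  A switching of the product restricts to any copy of \<open>\<Sigma>1\<close>. Conversely, a switching \<open>\<zeta>\<close>
  of \<open>\<Sigma>1\<close> lifts to the product by copying \<open>\<zeta> u\<close> along the fibre over \<open>u\<close>; the edges inside
  a fibre stay positive because \<open>\<zeta> u \<bullet> \<zeta> u > 0\<close>, provided \<open>\<zeta> u \<noteq> 0\<close>. Since \<open>\<zeta>\<close> can vanish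
  only at isolated vertices, it may be replaced there by the all-ones vector.
\<close>

text \<open>Since \<open>sgn 0 = 0\<close>, a sign product equal to 1 already forces a nonzero inner
  product, so one equation per arc replaces both conditions on the arcs.\<close>

lemma balancing_switching_iff:
  "switching_function k \<Sigma> \<zeta> \<and> all_positive (switch \<zeta> \<Sigma>) \<longleftrightarrow>
     \<zeta> \<in> sverts \<Sigma> \<rightarrow> Omega k \<and>
     (\<forall>(u, v) \<in> sarcs \<Sigma>. signature \<Sigma> (u, v) * sgn (\<zeta> u \<bullet> \<zeta> v) = 1)"
  by (fastforce simp: switching_function_def all_positive_def switch_def)

lemma scalar_prod_self_pos:
  fixes x :: "real vec"
  assumes "x \<in> carrier_vec k" "x \<noteq> 0\<^sub>v k"
  shows "x \<bullet> x > 0"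
proof -
  obtain i where "i < k" "x $ i \<noteq> 0"
    using assms by (metis carrier_vecD eq_vecI index_zero_vec)
  then have "(\<Sum>i = 0..<k. x $ i * x $ i) > 0"
    by (intro sum_pos2[of _ i]) (auto simp: zero_less_mult_iff linorder_neq_iff)
  then show ?thesis
    using assms(1) by (simp add: scalar_prod_def)
qed

text \<open>For a connected graph this repair matters only when there is a single vertex: the zero
  vector is then an admissible value, but its lift would fail on the edges of the fibre.\<close>

lemma nonvanishing_balancing_switching:
  assumes G: "pair_graph (underlying \<Sigma>)" and k: "1 \<le> k"
    and \<zeta>: "switching_function k \<Sigma> \<zeta>" "all_positive (switch \<zeta> \<Sigma>)"
  obtains \<xi> where "switching_function k \<Sigma> \<xi>" "all_positive (switch \<xi> \<Sigma>)"
    "\<And>u. u \<in> sverts \<Sigma> \<Longrightarrow> \<xi> u \<bullet> \<xi> u > 0"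
proof -
  interpret pair_graph "underlying \<Sigma>" by fact
  \<comment> \<open>The all-ones vector lies in \<open>Omega k\<close> and has inner product
    \<open>k\<close> with itself, which is positive because \<open>1 \<le> k\<close>.\<close>
  define \<xi> where "\<xi> u = (if \<zeta> u = 0\<^sub>v k then vec k (\<lambda>_. 1) else \<zeta> u)" for u
  have \<zeta>_Omega: "\<zeta> \<in> sverts \<Sigma> \<rightarrow> Omega k"
    and pos: "\<And>u v. (u, v) \<in> sarcs \<Sigma> \<Longrightarrow> signature \<Sigma> (u, v) * sgn (\<zeta> u \<bullet> \<zeta> v) = 1"
    using balancing_switching_iff[of k \<Sigma> \<zeta>] \<zeta> by auto
  then have carrier: "\<zeta> u \<in> carrier_vec k" if "u \<in> sverts \<Sigma>" for u
    using that by (auto simp: Omega_def)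
  have eq: "\<xi> u = \<zeta> u" "\<xi> v = \<zeta> v" if uv: "(u, v) \<in> sarcs \<Sigma>" for u v
  proof -
    have "u \<in> sverts \<Sigma>" "v \<in> sverts \<Sigma>"
      using uv by (auto dest: in_arcsD1 in_arcsD2)
    \<comment> \<open>A zero vector at either end would make the sign product in \<open>pos\<close>
      equal to 0 instead of 1.\<close>
    then have "\<zeta> u \<noteq> 0\<^sub>v k" "\<zeta> v \<noteq> 0\<^sub>v k"
      using pos[OF uv] carrier by auto
    then show "\<xi> u = \<zeta> u" "\<xi> v = \<zeta> v"
      by (simp_all add: \<xi>_def)
  qed
  have "\<xi> \<in> sverts \<Sigma> \<rightarrow> Omega k"
    using \<zeta>_Omega by (fastforce simp: \<xi>_def Omega_def Pi_iff)
  moreover have "\<forall>(u, v) \<in> sarcs \<Sigma>. signature \<Sigma> (u, v) * sgn (\<xi> u \<bullet> \<xi> v) = 1"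
    using pos eq by fastforce
  ultimately have "switching_function k \<Sigma> \<xi> \<and> all_positive (switch \<xi> \<Sigma>)"
    by (simp add: balancing_switching_iff)
  moreover have "\<xi> u \<bullet> \<xi> u > 0" if "u \<in> sverts \<Sigma>" for u
    using scalar_prod_self_pos[of "\<zeta> u" k] carrier[OF that] k
    by (auto simp: \<xi>_def scalar_prod_def)
  ultimately show thesis
    using that by blast
qed

text \<open>This gives the upper bound: every dimension that balances \<open>\<Sigma>1\<close> also
  balances the product.\<close>

lemma balancing_switching_HG_lex_product_lift:
  assumes G: "pair_graph (underlying \<Sigma>1)" and k: "1 \<le> k" and pos: "all_positive \<Sigma>2"
    and "switching_function k \<Sigma>1 \<zeta>" "all_positive (switch \<zeta> \<Sigma>1)"
  shows "\<exists>\<xi>. switching_function k (HG_lex_product \<Sigma>1 \<Sigma>2) \<xi> \<and>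
    all_positive (switch \<xi> (HG_lex_product \<Sigma>1 \<Sigma>2))"
proof -
  interpret pair_graph "underlying \<Sigma>1" by fact
  obtain \<xi> where \<xi>: "switching_function k \<Sigma>1 \<xi>" "all_positive (switch \<xi> \<Sigma>1)"
    and self: "\<And>u. u \<in> sverts \<Sigma>1 \<Longrightarrow> \<xi> u \<bullet> \<xi> u > 0"
    using nonvanishing_balancing_switching[OF G k assms(4,5)] by blast
  have \<xi>_Omega: "\<xi> \<in> sverts \<Sigma>1 \<rightarrow> Omega k"
    and 1: "\<And>u v. (u, v) \<in> sarcs \<Sigma>1 \<Longrightarrow> signature \<Sigma>1 (u, v) * sgn (\<xi> u \<bullet> \<xi> v) = 1"
    using balancing_switching_iff[of k \<Sigma>1 \<xi>] \<xi> by auto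
  have 2: "signature \<Sigma>2 (v, v') = 1" if "(v, v') \<in> sarcs \<Sigma>2" for v v'
    using pos that by (auto simp: all_positive_def)
  have "(\<xi> \<circ> fst) \<in> sverts (HG_lex_product \<Sigma>1 \<Sigma>2) \<rightarrow> Omega k"
    using \<xi>_Omega by (auto simp: HG_lex_product_def lex_graph_def)
  \<comment> \<open>An arc coming from \<open>\<Sigma>1\<close> joins distinct first coordinates, as
    there are no loops, so its sign is that of \<open>\<Sigma>1\<close> and \<open>1\<close>
    applies. On an arc within a fibre the sign is 1 by \<open>2\<close>, and \<open>self\<close>
    makes the inner product positive.\<close>
  moreover have "\<forall>(x, y) \<in> sarcs (HG_lex_product \<Sigma>1 \<Sigma>2).
      signature (HG_lex_product \<Sigma>1 \<Sigma>2) (x, y) * sgn ((\<xi> \<circ> fst) x \<bullet> (\<xi> \<circ> fst) y) = 1"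
    using 1 2 self by (auto simp: HG_lex_product_def lex_graph_def dest: no_loops')
  ultimately show ?thesis
    by (auto simp only: balancing_switching_iff)
qed

text \<open>The vertices with second coordinate \<open>w\<close> carry a signed copy of
  \<open>\<Sigma>1\<close>, which gives the lower bound.\<close>

lemma balancing_switching_HG_lex_product_restrict:
  assumes G: "pair_graph (underlying \<Sigma>1)" and w: "w \<in> sverts \<Sigma>2"
    and "switching_function k (HG_lex_product \<Sigma>1 \<Sigma>2) \<xi>"
      "all_positive (switch \<xi> (HG_lex_product \<Sigma>1 \<Sigma>2))"
  shows "switching_function k \<Sigma>1 (\<lambda>u. \<xi> (u, w)) \<and>
    all_positive (switch (\<lambda>u. \<xi> (u, w)) \<Sigma>1)"
proof -
  interpret pair_graph "underlying \<Sigma>1" by fact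
  have \<xi>_Omega: "\<xi> \<in> sverts (HG_lex_product \<Sigma>1 \<Sigma>2) \<rightarrow> Omega k"
    and 1: "\<And>x y. (x, y) \<in> sarcs (HG_lex_product \<Sigma>1 \<Sigma>2) \<Longrightarrow>
      signature (HG_lex_product \<Sigma>1 \<Sigma>2) (x, y) * sgn (\<xi> x \<bullet> \<xi> y) = 1"
    using balancing_switching_iff[of k "HG_lex_product \<Sigma>1 \<Sigma>2" \<xi>] assms(3,4) by auto
  have "signature \<Sigma>1 (u, v) * sgn (\<xi> (u, w) \<bullet> \<xi> (v, w)) = 1" if uv: "(u, v) \<in> sarcs \<Sigma>1" for u v
  proof -
    \<comment> \<open>Distinctness selects the \<open>\<Sigma>1\<close> branch in the signature of
      the product.\<close>
    have "u \<noteq> v" "u \<in> sverts \<Sigma>1" "v \<in> sverts \<Sigma>1"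
      using uv no_loops' by (auto dest: in_arcsD1 in_arcsD2)
    then show ?thesis
      using 1[of "(u, w)" "(v, w)"] uv w by (simp add: HG_lex_product_def lex_graph_def)
  qed
  moreover have "(\<lambda>u. \<xi> (u, w)) \<in> sverts \<Sigma>1 \<rightarrow> Omega k"
    using \<xi>_Omega w by (auto simp: HG_lex_product_def lex_graph_def)
  ultimately show ?thesis
    by (auto simp only: balancing_switching_iff)
qed

theorem theorem2p18:
  fixes \<Sigma>1 :: "'a signed_pre_graph" and \<Sigma>2 :: "'b signed_pre_graph"
  assumes "connected_signed_graph \<Sigma>1"
    and "connected_signed_graph \<Sigma>2"
    and "all_positive \<Sigma>2"
  shows "bdim (HG_lex_product \<Sigma>1 \<Sigma>2) = bdim \<Sigma>1"
proof -
  have G: "pair_graph (underlying \<Sigma>1)"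
    using assms(1) by (rule connected_signed_graph.pair_graph_underlying)
  \<comment> \<open>Connectedness includes having a vertex, so there is a fibre coordinate at which
    to restrict.\<close>
  obtain w where w: "w \<in> sverts \<Sigma>2"
    using connected_signed_graph.connected_underlying[OF assms(2)]
      connected_iff_strongly_connected[OF
        connected_signed_graph.pair_graph_underlying[OF assms(2)]]
    by (auto simp: strongly_connected_def)
  \<comment> \<open>The predicates under \<open>LEAST\<close> agree for each \<open>k\<close>, so
    the two minima coincide. The conjunct \<open>1 \<le> k\<close> supplies the bound required for
    lifting.\<close>
  have "(1 \<le> k \<and> (\<exists>\<xi>. switching_function k (HG_lex_product \<Sigma>1 \<Sigma>2) \<xi> \<and>
          all_positive (switch \<xi> (HG_lex_product \<Sigma>1 \<Sigma>2)))) \<longleftrightarrow>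
        (1 \<le> k \<and> (\<exists>\<zeta>. switching_function k \<Sigma>1 \<zeta> \<and> all_positive (switch \<zeta> \<Sigma>1)))" for k
    using balancing_switching_HG_lex_product_lift[OF G _ assms(3)]
      balancing_switching_HG_lex_product_restrict[OF G w] by blast
  then show ?thesis
    by (simp only: bdim_def)
qed

end
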